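(* Let $\mathcal E_{\mathrm{sim}}=\sigma_x^u\circ\mathcal E_\eta\circ\mathcal E_P$, where $u\in\{0,1\}$, $\mathcal E_\eta$ is the amplitude damping channel with parameter $\eta\in[0,1]$, and $\mathcal E_P$ is the Pauli channel with parameters $(q_1,q_2,q_3)\in\mathcal T$. Then the Pauli channel closest to $\mathcal E_{\mathrm{sim}}$ in diamond norm distance is the same as the closest one in trace norm distance, namely $\mathcal E_{\mathrm{cl}}:(x,y,z)\mapsto(f_{11}x,f_{22}y,f_{33}z)$ with $$(f_{11},f_{22},f_{33})=\begin{cases}\big(\sqrt{1-\eta}\,q_1,\,-\sqrt{1-\eta}\,q_2,\,(1-\eta)q_3\big)&\text{for }u=0,\\ \big(\sqrt{1-\eta}\,q_1,\,\sqrt{1-\eta}\,q_2,\,-(1-\eta)q_3\big)&\text{for }u=1,\end{cases}$$ and the diamond norm distance $\|\mathcal E_{\mathrm{sim}}-\mathcal E_{\mathrm{cl}}\|_\diamond$ is equal to $\eta$.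
   Context: The Bloch vector $(x,y,z)$ of a qubit state $\rho$ is defined by $\rho=\frac12(I+x\sigma_x+y\sigma_y+z\sigma_z)$, and qubit channels are described by their action on Bloch vectors. In compositions, $\sigma_x$ denotes the unitary channel $\rho\mapsto\sigma_x\rho\sigma_x^\dagger$. The amplitude damping channel $\mathcal E_\eta$ acts as $(x,y,z)\mapsto(\sqrt{1-\eta}\,x,\sqrt{1-\eta}\,y,\eta+(1-\eta)z)$. $\mathcal T$ is the tetrahedron with vertices $(1,-1,1),(1,1,-1),(-1,-1,-1),(-1,1,1)$ (convex hull). The Pauli channels are exactly the channels $\rho\mapsto\sum_{i=0}^3p_i\sigma_i\rho\sigma_i$ with $(p_i)$ a probability distribution and $(\sigma_0,\dots,\sigma_3)=(I,\sigma_x,\sigma_y,\sigma_z)$; equivalently, they act as $(x,y,z)\mapsto(c_1x,-c_2y,c_3z)$ with parameters $(c_1,c_2,c_3)\in\mathcal T$. With $\|\sigma\|_1=\mathrm{Tr}\sqrt{\sigma\sigma^\dagger}$, the trace norm distance between two channels is $\|\mathcal E_1-\mathcal E_2\|_1:=\sup_\rho\|\mathcal E_1(\rho)-\mathcal E_2(\rho)\|_1$ over input states $\rho$. The diamond norm distance is $\|\mathcal E_1-\mathcal E_2\|_\diamond:=\sup_{\rho}\|(\mathbb I_\kappa\otimes\mathcal E_1)(\rho)-(\mathbb I_\kappa\otimes\mathcal E_2)(\rho)\|_1$, the supremum being over states $\rho$ on $\kappa\otimes\mathcal H$, where $\mathcal H$ is the input space and $\kappa$ is an ancillary Hilbert space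 (for qubit channels it suffices to take $\kappa=\mathbb C^2$). *)

theory Defs
  imports "Jordan_Normal_Form.Schur_Decomposition" "HOL-Analysis.Convex"
    "HOL-Library.Extended_Real"
begin

definition trace :: "complex mat \<Rightarrow> complex" where
  "trace A = (\<Sum>i<dim_row A. A $$ (i, i))"

text \<open>In the order on \<^typ>\<open>complex\<close> used here, \<open>0 \<le> c\<close> says that \<open>c\<close> is real and nonnegative,
  so the matrices below are automatically Hermitian.\<close>

definition psd :: "nat \<Rightarrow> complex mat set" where
  "psd n = {A \<in> carrier_mat n n. \<forall>v \<in> carrier_vec n. 0 \<le> (A *\<^sub>v v) \<bullet>c v}"

definition mat_sqrt :: "complex mat \<Rightarrow> complex mat" where
  "mat_sqrt A = (THE S. S \<in> psd (dim_row A) \<and> S * S = A)"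

definition trace_norm :: "complex mat \<Rightarrow> real" where
  "trace_norm A = Re (trace (mat_sqrt (A * mat_adjoint A)))"

definition density :: "nat \<Rightarrow> complex mat set" where
  "density n = {\<rho> \<in> psd n. trace \<rho> = 1}"

text \<open>Qubit maps are functions on complex matrices of which only the values on
  \<open>carrier_mat 2 2\<close> matter. The suprema are taken in the extended reals, so that they are
  meaningful without a separate boundedness argument.\<close>

type_synonym qmap = "complex mat \<Rightarrow> complex mat"

definition same_channel :: "qmap \<Rightarrow> qmap \<Rightarrow> bool" where
  "same_channel E F \<longleftrightarrow> (\<forall>\<rho> \<in> carrier_mat 2 2. E \<rho> = F \<rho>)"

definition trace_dist :: "qmap \<Rightarrow> qmap \<Rightarrow> ereal" where
  "trace_dist E F = (SUP \<rho> \<in> density 2. ereal (trace_norm (E \<rho> - F \<rho>)))"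

text \<open>The basis vector \<open>e\<^sub>a \<otimes> e\<^sub>b\<close> of \<open>\<complex>\<^sup>k \<otimes> \<complex>\<^sup>2\<close> has index \<open>2 * a + b\<close>. For linear \<open>E\<close> the map
  \<open>id \<otimes> E\<close> applies \<open>E\<close> to each of the \<open>k * k\<close> blocks of size \<open>2 \<times> 2\<close>.\<close>

definition block :: "complex mat \<Rightarrow> nat \<Rightarrow> nat \<Rightarrow> complex mat" where
  "block R a a' = mat 2 2 (\<lambda>(b, b'). R $$ (2 * a + b, 2 * a' + b'))"

definition id_tensor :: "nat \<Rightarrow> qmap \<Rightarrow> qmap" where
  "id_tensor k E R =
     mat (2 * k) (2 * k) (\<lambda>(i, j). E (block R (i div 2) (j div 2)) $$ (i mod 2, j mod 2))"

definition kronecker :: "complex mat \<Rightarrow> complex mat \<Rightarrow> complex mat" where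
  "kronecker A B = mat (dim_row A * dim_row B) (dim_col A * dim_col B)
     (\<lambda>(i, j). A $$ (i div dim_row B, j div dim_col B) * B $$ (i mod dim_row B, j mod dim_col B))"

lemma id_tensor_kronecker:
  assumes A: "A \<in> carrier_mat k k" and B: "B \<in> carrier_mat 2 2" and EB: "E B \<in> carrier_mat 2 2"
    and hom: "\<And>c. E (c \<cdot>\<^sub>m B) = c \<cdot>\<^sub>m E B"
  shows "id_tensor k E (kronecker A B) = kronecker A (E B)"
proof (rule eq_matI)
  fix i j
  assume "i < dim_row (kronecker A (E B))" "j < dim_col (kronecker A (E B))"
  then have ij: "i < 2 * k" "j < 2 * k"
    using A EB by (auto simp: kronecker_def)
  then have d: "i div 2 < k" "j div 2 < k" by auto
  have l: "2 * a + b < 2 * k" if "a < k" "b < 2" for a b :: nat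
    using that by linarith
  have "block (kronecker A B) (i div 2) (j div 2) = A $$ (i div 2, j div 2) \<cdot>\<^sub>m B"
    using A B d by (intro eq_matI) (auto simp: block_def kronecker_def l mult.commute[of k 2])
  then show "id_tensor k E (kronecker A B) $$ (i, j) = kronecker A (E B) $$ (i, j)"
    using A EB ij by (simp add: id_tensor_def kronecker_def hom mult.commute[of k 2])
qed (use A EB in \<open>auto simp: id_tensor_def kronecker_def\<close>)

text \<open>The ancilla ranges over all nonzero finite dimensions.\<close>

definition diamond_dist :: "qmap \<Rightarrow> qmap \<Rightarrow> ereal" where
  "diamond_dist E F = (SUP k \<in> {1..}. SUP \<rho> \<in> density (2 * k).
     ereal (trace_norm (id_tensor k E \<rho> - id_tensor k F \<rho>)))"

definition sigma_x :: "complex mat" where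
  "sigma_x = mat_of_rows_list 2 [[0, 1], [1, 0]]"

definition sigma_y :: "complex mat" where
  "sigma_y = mat_of_rows_list 2 [[0, - \<i>], [\<i>, 0]]"

definition sigma_z :: "complex mat" where
  "sigma_z = mat_of_rows_list 2 [[1, 0], [0, - 1]]"

definition bloch_state :: "real \<Rightarrow> real \<Rightarrow> real \<Rightarrow> complex mat" where
  "bloch_state x y z = (1 / 2) \<cdot>\<^sub>m
     (1\<^sub>m 2 + of_real x \<cdot>\<^sub>m sigma_x + of_real y \<cdot>\<^sub>m sigma_y + of_real z \<cdot>\<^sub>m sigma_z)"

text \<open>The linear extension to all \<open>2 \<times> 2\<close> matrices of the Bloch vector map
  \<open>(x, y, z) \<mapsto> (a * x, b * y, t + c * z)\<close>: a matrix \<open>\<rho>\<close> has the Pauli coordinates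
  \<open>tr \<rho>\<close>, \<open>tr (\<sigma>\<^sub>x \<rho>)\<close>, \<open>tr (\<sigma>\<^sub>y \<rho>)\<close>, \<open>tr (\<sigma>\<^sub>z \<rho>)\<close>, and the shift \<open>t\<close> is scaled by \<open>tr \<rho>\<close>.\<close>

definition bloch_map :: "real \<Rightarrow> real \<Rightarrow> real \<Rightarrow> real \<Rightarrow> qmap" where
  "bloch_map a b c t \<rho> = (1 / 2) \<cdot>\<^sub>m
     (trace \<rho> \<cdot>\<^sub>m 1\<^sub>m 2 + (of_real a * trace (sigma_x * \<rho>)) \<cdot>\<^sub>m sigma_x
      + (of_real b * trace (sigma_y * \<rho>)) \<cdot>\<^sub>m sigma_y
      + (of_real t * trace \<rho> + of_real c * trace (sigma_z * \<rho>)) \<cdot>\<^sub>m sigma_z)"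

definition amplitude_damping :: "real \<Rightarrow> qmap" where
  "amplitude_damping \<eta> = bloch_map (sqrt (1 - \<eta>)) (sqrt (1 - \<eta>)) (1 - \<eta>) \<eta>"

definition unitary_channel :: "complex mat \<Rightarrow> qmap" where
  "unitary_channel U \<rho> = U * \<rho> * mat_adjoint U"

definition tetrahedron :: "(real \<times> real \<times> real) set" where
  "tetrahedron = convex hull {(1, - 1, 1), (1, 1, - 1), (- 1, - 1, - 1), (- 1, 1, 1)}"

definition pauli_map :: "real \<Rightarrow> real \<Rightarrow> real \<Rightarrow> qmap" where
  "pauli_map c1 c2 c3 = bloch_map c1 (- c2) c3 0"

definition pauli_mixture :: "real \<Rightarrow> real \<Rightarrow> real \<Rightarrow> real \<Rightarrow> qmap" where
  "pauli_mixture p0 p1 p2 p3 \<rho> =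
     of_real p0 \<cdot>\<^sub>m \<rho> + of_real p1 \<cdot>\<^sub>m (sigma_x * \<rho> * sigma_x)
     + of_real p2 \<cdot>\<^sub>m (sigma_y * \<rho> * sigma_y) + of_real p3 \<cdot>\<^sub>m (sigma_z * \<rho> * sigma_z)"

definition pauli_channels :: "qmap set" where
  "pauli_channels = {E. \<exists>p0 p1 p2 p3. 0 \<le> p0 \<and> 0 \<le> p1 \<and> 0 \<le> p2 \<and> 0 \<le> p3 \<and> p0 + p1 + p2 + p3 = 1
     \<and> same_channel E (pauli_mixture p0 p1 p2 p3)}"

definition closest_pauli :: "(qmap \<Rightarrow> qmap \<Rightarrow> ereal) \<Rightarrow> qmap \<Rightarrow> qmap \<Rightarrow> bool" where
  "closest_pauli d E C \<longleftrightarrow> is_arg_min (d E) (\<lambda>C. C \<in> pauli_channels) C"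

lemmas two_by_two = mat_of_rows_list_def scalar_prod_def trace_def numeral_2_eq_2

lemma sigma_carrier [simp]:
  "sigma_x \<in> carrier_mat 2 2" "sigma_y \<in> carrier_mat 2 2" "sigma_z \<in> carrier_mat 2 2"
  by (auto simp: sigma_x_def sigma_y_def sigma_z_def mat_of_rows_list_def)

lemma bloch_map_bloch_state:
  "bloch_map a b c t (bloch_state x y z) = bloch_state (a * x) (b * y) (t + c * z)"
  by (rule eq_matI)
    (auto simp: bloch_map_def bloch_state_def sigma_x_def sigma_y_def sigma_z_def
      two_by_two less_Suc_eq field_simps complex_eq_iff)

lemma amplitude_damping_bloch_state:
  "amplitude_damping \<eta> (bloch_state x y z) =
     bloch_state (sqrt (1 - \<eta>) * x) (sqrt (1 - \<eta>) * y) (\<eta> + (1 - \<eta>) * z)"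
  by (simp add: amplitude_damping_def bloch_map_bloch_state)

lemma pauli_map_bloch_state:
  "pauli_map c1 c2 c3 (bloch_state x y z) = bloch_state (c1 * x) (- c2 * y) (c3 * z)"
  by (simp add: pauli_map_def bloch_map_bloch_state)

lemma pauli_mixture_bloch:
  assumes "p0 + p1 + p2 + p3 = 1"
  shows "same_channel (pauli_mixture p0 p1 p2 p3)
     (pauli_map (p0 + p1 - p2 - p3) (- p0 + p1 - p2 + p3) (p0 - p1 - p2 + p3))"
  unfolding same_channel_def
proof
  fix \<rho> :: "complex mat"
  assume \<rho>: "\<rho> \<in> carrier_mat 2 2"
  have p0: "p0 = 1 - p1 - p2 - p3"
    using assms by simp
  show "pauli_mixture p0 p1 p2 p3 \<rho> =
      pauli_map (p0 + p1 - p2 - p3) (- p0 + p1 - p2 + p3) (p0 - p1 - p2 + p3) \<rho>"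
    unfolding p0 using \<rho>
    by (intro eq_matI)
      (auto simp: pauli_mixture_def pauli_map_def bloch_map_def sigma_x_def sigma_y_def sigma_z_def
        two_by_two less_Suc_eq complex_eq_iff algebra_simps)
qed

lemma tetrahedron_iff:
  "(c1, c2, c3) \<in> tetrahedron \<longleftrightarrow>
     (\<exists>p0 p1 p2 p3. 0 \<le> p0 \<and> 0 \<le> p1 \<and> 0 \<le> p2 \<and> 0 \<le> p3 \<and> p0 + p1 + p2 + p3 = 1
       \<and> c1 = p0 + p1 - p2 - p3 \<and> c2 = - p0 + p1 - p2 + p3 \<and> c3 = p0 - p1 - p2 + p3)" (is "_ \<longleftrightarrow> ?R")
proof
  let ?w = "\<lambda>p0 p1 p2 p3 :: real. (p0 + p1 - p2 - p3, - p0 + p1 - p2 + p3, p0 - p1 - p2 + p3)"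
  let ?Q = "\<lambda>p0 p1 p2 p3 :: real. 0 \<le> p0 \<and> 0 \<le> p1 \<and> 0 \<le> p2 \<and> 0 \<le> p3 \<and> p0 + p1 + p2 + p3 = 1"
  let ?S = "{v. \<exists>p0 p1 p2 p3. ?Q p0 p1 p2 p3 \<and> v = ?w p0 p1 p2 p3}"
  assume "(c1, c2, c3) \<in> tetrahedron"
  moreover have "tetrahedron \<subseteq> ?S"
    unfolding tetrahedron_def
  proof (rule hull_minimal)
    have "?w p0 p1 p2 p3 \<in> ?S" if "?Q p0 p1 p2 p3" for p0 p1 p2 p3
      using that by blast
    from this[of 1 0 0 0] this[of 0 1 0 0] this[of 0 0 1 0] this[of 0 0 0 1]
    show "{(1, - 1, 1), (1, 1, - 1), (- 1, - 1, - 1), (- 1, 1, 1)} \<subseteq> ?S"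
      by (simp del: mem_Collect_eq)
    show "convex ?S"
    proof (rule convexI)
      fix x y and r s :: real
      assume "x \<in> ?S" "y \<in> ?S" and rs: "0 \<le> r" "0 \<le> s" "r + s = 1"
      then obtain p0 p1 p2 p3 q0 q1 q2 q3 where
        p: "?Q p0 p1 p2 p3" "x = ?w p0 p1 p2 p3" and q: "?Q q0 q1 q2 q3" "y = ?w q0 q1 q2 q3"
        by blast
      have "r * p0 + s * q0 + (r * p1 + s * q1) + (r * p2 + s * q2) + (r * p3 + s * q3)
          = r * (p0 + p1 + p2 + p3) + s * (q0 + q1 + q2 + q3)"
        by (simp add: algebra_simps)
      then have "?Q (r * p0 + s * q0) (r * p1 + s * q1) (r * p2 + s * q2) (r * p3 + s * q3)"
        using p(1) q(1) rs by simp
      moreover have "r *\<^sub>R x + s *\<^sub>R y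
          = ?w (r * p0 + s * q0) (r * p1 + s * q1) (r * p2 + s * q2) (r * p3 + s * q3)"
        by (simp add: p(2) q(2) algebra_simps)
      ultimately show "r *\<^sub>R x + s *\<^sub>R y \<in> ?S" by blast
    qed
  qed
  ultimately show ?R by blast
next
  assume ?R
  then obtain p0 p1 p2 p3 where p: "0 \<le> p0" "0 \<le> p1" "0 \<le> p2" "0 \<le> p3" "p0 + p1 + p2 + p3 = 1"
    and c: "c1 = p0 + p1 - p2 - p3" "c2 = - p0 + p1 - p2 + p3" "c3 = p0 - p1 - p2 + p3"
    by blast
  let ?V = "{(1, - 1, 1), (1, 1, - 1), (- 1, - 1, - 1), (- 1, 1, 1)} :: (real \<times> real \<times> real) set"
  let ?p = "\<lambda>v. if v = (1, - 1, 1) then p0 else if v = (1, 1, - 1) then p1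
    else if v = (- 1, - 1, - 1) then p2 else p3"
  have "(\<Sum>v\<in>?V. ?p v *\<^sub>R v) \<in> convex hull ?V"
  proof (rule convex_sum)
    show "sum ?p ?V = 1" using p by simp
    show "v \<in> convex hull ?V" if "v \<in> ?V" for v using that by (rule hull_inc)
  qed (use p in auto)
  moreover have "(\<Sum>v\<in>?V. ?p v *\<^sub>R v) = (c1, c2, c3)"
    using c by simp
  ultimately show "(c1, c2, c3) \<in> tetrahedron"
    by (simp add: tetrahedron_def)
qed

lemma pauli_channels_iff:
  "E \<in> pauli_channels \<longleftrightarrow>
     (\<exists>c1 c2 c3. (c1, c2, c3) \<in> tetrahedron \<and> same_channel E (pauli_map c1 c2 c3))"
proof -
  have "same_channel E (pauli_mixture p0 p1 p2 p3) \<longleftrightarrow> same_channel E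
      (pauli_map (p0 + p1 - p2 - p3) (- p0 + p1 - p2 + p3) (p0 - p1 - p2 + p3))"
    if "p0 + p1 + p2 + p3 = 1" for p0 p1 p2 p3
    using pauli_mixture_bloch[OF that] by (simp add: same_channel_def)
  then show ?thesis
    unfolding pauli_channels_def tetrahedron_iff mem_Collect_eq by metis
qed

end

theory Submission
  imports Defs
begin

text \<open>The simulated channel acts on Bloch vectors as \<open>(f\<^sub>1\<^sub>1 x, f\<^sub>2\<^sub>2 y, t + f\<^sub>3\<^sub>3 z)\<close> with \<open>\<bar>t\<bar> = \<eta>\<close>, so
  its difference from \<open>E_cl\<close> is \<open>\<rho> \<mapsto> tr \<rho> (t/2) \<sigma>\<^sub>z\<close>. Tensored with the identity this gives
  \<open>P \<otimes> (t/2) \<sigma>\<^sub>z\<close>, where \<open>P\<close> is the reduced state of the ancilla, whose trace norm is \<open>\<bar>t\<bar>\<close> for every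
  input state. Conversely, the pure states on the Bloch axes show that any Pauli channel has trace
  distance at least \<open>\<bar>t\<bar>\<close> from the simulated channel, and more than \<open>\<bar>t\<bar>\<close> unless it equals \<open>E_cl\<close>.
  Since the diamond distance dominates the trace distance, both minimisation problems have this one
  solution.\<close>

section \<open>Positive semidefinite matrices and the trace norm\<close>

lemma mat_adjoint_carrier [simp]: "A \<in> carrier_mat n m \<Longrightarrow> mat_adjoint A \<in> carrier_mat m n"
  by (auto simp: mat_adjoint_def)

lemma mat_adjoint_dim [simp]:
  "dim_row (mat_adjoint A) = dim_col A" "dim_col (mat_adjoint A) = dim_row A"
  by (auto simp: mat_adjoint_def)

lemma mat_adjoint_index [simp]:
  assumes "i < dim_col A" "j < dim_row A"
  shows "mat_adjoint A $$ (i, j) = conjugate (A $$ (j, i))"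
  using assms by (simp add: mat_adjoint_def mat_of_rows_index)

lemma mat_adjoint_eq_mat: "mat_adjoint A = mat (dim_col A) (dim_row A) (\<lambda>(i, j). conjugate (A $$ (j, i)))"
  by (rule eq_matI) auto

lemma trace_mult_commute:
  assumes A: "A \<in> carrier_mat n m" and B: "B \<in> carrier_mat m n"
  shows "trace (A * B) = trace (B * A)"
proof -
  have "trace (A * B) = (\<Sum>i<n. \<Sum>j<m. A $$ (i, j) * B $$ (j, i))"
    using A B by (simp add: trace_def scalar_prod_def atLeast0LessThan)
  also have "\<dots> = (\<Sum>j<m. \<Sum>i<n. A $$ (i, j) * B $$ (j, i))"
    by (rule sum.swap)
  also have "\<dots> = trace (B * A)"
    using A B by (simp add: trace_def scalar_prod_def atLeast0LessThan mult.commute)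
  finally show ?thesis .
qed

lemma psd_carrier: "A \<in> psd n \<Longrightarrow> A \<in> carrier_mat n n"
  by (simp add: psd_def)

lemma psd_form_nonneg: "A \<in> psd n \<Longrightarrow> v \<in> carrier_vec n \<Longrightarrow> 0 \<le> (A *\<^sub>v v) \<bullet>c v"
  by (simp add: psd_def)

lemma form_add_smult:
  fixes A :: "complex mat"
  assumes A: "A \<in> carrier_mat n n" and x: "x \<in> carrier_vec n" and y: "y \<in> carrier_vec n"
  shows "(A *\<^sub>v (x + c \<cdot>\<^sub>v y)) \<bullet>c (x + c \<cdot>\<^sub>v y) =
    (A *\<^sub>v x) \<bullet>c x + cnj c * ((A *\<^sub>v x) \<bullet>c y) + c * ((A *\<^sub>v y) \<bullet>c x) + c * cnj c * ((A *\<^sub>v y) \<bullet>c y)"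
proof -
  have [simp]: "A *\<^sub>v x \<in> carrier_vec n" "A *\<^sub>v y \<in> carrier_vec n"
    using assms by auto
  have "A *\<^sub>v (x + c \<cdot>\<^sub>v y) = A *\<^sub>v x + c \<cdot>\<^sub>v (A *\<^sub>v y)"
    using assms by (simp add: mult_add_distrib_mat_vec[of _ n n] mult_mat_vec[of _ n n])
  moreover have "conjugate (x + c \<cdot>\<^sub>v y) = conjugate x + cnj c \<cdot>\<^sub>v conjugate y"
    using assms by (simp add: conjugate_add_vec[of _ n] conjugate_smult_vec)
  ultimately show ?thesis
    using assms
    by (simp add: add_scalar_prod_distrib[of _ n] scalar_prod_add_distrib[of _ n] algebra_simps)
qed

text \<open>Polarisation. Nonnegativity in the complex order makes every diagonal value of the form
  real. Expanding it at x + c y, the choice c = 1 makes the imaginary parts of the two cross terms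
  cancel and c = i makes their real parts agree.\<close>

lemma psd_form_cnj:
  assumes A: "A \<in> psd n" and x: "x \<in> carrier_vec n" and y: "y \<in> carrier_vec n"
  shows "(A *\<^sub>v y) \<bullet>c x = cnj ((A *\<^sub>v x) \<bullet>c y)"
proof -
  have im: "Im ((A *\<^sub>v v) \<bullet>c v) = 0" if "v \<in> carrier_vec n" for v
    using psd_form_nonneg[OF A that] by (simp add: less_eq_complex_def)
  have "Im ((A *\<^sub>v (x + c \<cdot>\<^sub>v y)) \<bullet>c (x + c \<cdot>\<^sub>v y)) = 0" for c
    using x y by (intro im) auto
  from this[of 1] this[of \<i>] show ?thesis
    unfolding form_add_smult[OF psd_carrier[OF A] x y] using im[OF x] im[OF y]
    by (simp add: complex_eq_iff)
qed

lemma psd_hermitian: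
  assumes A: "A \<in> psd n"
  shows "mat_adjoint A = A"
proof (rule eq_matI)
  have c: "A \<in> carrier_mat n n"
    using A by (rule psd_carrier)
  have e: "(A *\<^sub>v unit_vec n j) \<bullet>c unit_vec n i = A $$ (i, j)" if "i < n" "j < n" for i j
  proof -
    have "conjugate (unit_vec n i) = (unit_vec n i :: complex vec)"
      by (intro eq_vecI) (auto simp: unit_vec_def)
    then show ?thesis
      using that c by simp
  qed
  fix i j
  assume "i < dim_row A" "j < dim_col A"
  then have ij: "i < n" "j < n" using c by auto
  have "A $$ (i, j) = cnj (A $$ (j, i))"
    using psd_form_cnj[OF A, of "unit_vec n i" "unit_vec n j"] ij by (simp add: e)
  then show "mat_adjoint A $$ (i, j) = A $$ (i, j)"
    using ij c by simp
qed (use psd_carrier[OF A] mat_adjoint_carrier in auto)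

text \<open>Perturb x in the direction y = A x. The form at x + c y is 2 c r + c^2 d with r the
  squared norm of y, and its nonnegativity for all real c forces r = 0.\<close>

lemma psd_form_eq_0:
  assumes A: "A \<in> psd n" and x: "x \<in> carrier_vec n" and 0: "(A *\<^sub>v x) \<bullet>c x = 0"
  shows "A *\<^sub>v x = 0\<^sub>v n"
proof -
  let ?y = "A *\<^sub>v x"
  have y: "?y \<in> carrier_vec n"
    using psd_carrier[OF A] x by auto
  define r where "r = Re (?y \<bullet>c ?y)"
  define d where "d = Re ((A *\<^sub>v ?y) \<bullet>c ?y)"
  have r: "?y \<bullet>c ?y = of_real r"
    using conjugate_square_ge_0_vec[of ?y] by (simp add: r_def complex_eq_iff less_eq_complex_def)
  have d: "(A *\<^sub>v ?y) \<bullet>c ?y = of_real d" "0 \<le> d"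
    using psd_form_nonneg[OF A y] by (simp_all add: d_def complex_eq_iff less_eq_complex_def)
  have yx: "(A *\<^sub>v ?y) \<bullet>c x = of_real r"
    using psd_form_cnj[OF A x y] r by simp
  have "0 \<le> 2 * c * r + c\<^sup>2 * d" for c :: real
  proof -
    have "0 \<le> (A *\<^sub>v (x + of_real c \<cdot>\<^sub>v ?y)) \<bullet>c (x + of_real c \<cdot>\<^sub>v ?y)"
      using x y by (intro psd_form_nonneg[OF A]) auto
    then show ?thesis
      unfolding form_add_smult[OF psd_carrier[OF A] x y] 0 r yx d(1)
      by (simp add: less_eq_complex_def power2_eq_square algebra_simps)
  qed
  \<comment> \<open>The minimiser would be - r / d. Dividing by d + 1 instead avoids the case d = 0
    and still yields r^2 (d + 2) \<le> 0 after multiplication by (d + 1)^2.\<close>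
  moreover obtain c where c: "c * (d + 1) = - r"
    using d(2) by (metis add_nonneg_pos less_numeral_extra(1,3) nonzero_eq_divide_eq)
  ultimately have "0 \<le> (2 * c * r + c\<^sup>2 * d) * (d + 1)\<^sup>2"
    by simp
  also have "\<dots> = 2 * (c * (d + 1)) * r * (d + 1) + (c * (d + 1))\<^sup>2 * d"
    by (simp add: power2_eq_square algebra_simps)
  finally have "0 \<le> - 2 * r\<^sup>2 * (d + 1) + r\<^sup>2 * d"
    by (simp add: c power2_eq_square)
  then have "r\<^sup>2 * (d + 2) \<le> 0"
    by (simp add: power2_eq_square algebra_simps)
  then have "r = 0"
    using d(2) by (simp add: mult_le_0_iff)
  then show ?thesis
    using r y by simp
qed

text \<open>The diagonal entries of the product are the squared norms of the rows of D.\<close>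

lemma mult_adjoint_eq_0:
  fixes D :: "complex mat"
  assumes D: "D \<in> carrier_mat n n" and 0: "D * mat_adjoint D = 0\<^sub>m n n"
  shows "D = 0\<^sub>m n n"
proof (rule eq_matI)
  fix i j
  assume "i < dim_row (0\<^sub>m n n :: complex mat)" "j < dim_col (0\<^sub>m n n :: complex mat)"
  then have ij: "i < n" "j < n" by auto
  have "col (mat_adjoint D) i = conjugate (row D i)"
    using D ij by (intro eq_vecI) (auto simp: col_def)
  then have "row D i \<bullet>c row D i = (D * mat_adjoint D) $$ (i, i)"
    using D ij mat_adjoint_carrier[OF D] by simp
  then have "row D i = 0\<^sub>v n"
    using D ij conjugate_square_eq_0_vec[of "row D i" n] by (simp add: 0)
  then have "row D i $ j = 0"
    using ij by simp
  then show "D $$ (i, j) = 0\<^sub>m n n $$ (i, j)"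
    using D ij by simp
qed (use D in auto)

text \<open>For Hermitian D, row i is the conjugate of column i. So the trace of D S D is a sum of
  values of the form of S, nonnegative when S is psd.\<close>

lemma mult_form_diag:
  fixes D S :: "complex mat"
  assumes D: "D \<in> carrier_mat n n" "mat_adjoint D = D" and S: "S \<in> carrier_mat n n" and i: "i < n"
  shows "(D * (S * D)) $$ (i, i) = (S *\<^sub>v col D i) \<bullet>c col D i"
proof -
  have "row D i = conjugate (col D i)"
  proof (rule eq_vecI)
    fix j
    assume "j < dim_vec (conjugate (col D i))"
    then have "j < n" using D by auto
    then show "row D i $ j = conjugate (col D i) $ j"
      using D i mat_adjoint_index[of i D j] by auto
  qed (use D in auto)
  moreover have "col (S * D) i = S *\<^sub>v col D i"
    using S D(1) i by (rule col_mult2)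
  ultimately show ?thesis
    using D S i index_mult_mat(1)[of i D i "S * D"] comm_scalar_prod[of "conjugate (col D i)" n "S *\<^sub>v col D i"]
    by (auto simp del: index_mult_mat(1))
qed

text \<open>With \<open>D = S - T\<close>, equality of the squares gives \<open>S D = - D T\<close>, so
  \<open>tr (D S D) + tr (D T D) = 0\<close> is a sum of nonnegative terms; hence \<open>S D = T D = 0\<close>.\<close>

lemma psd_sqrt_unique:
  assumes S: "S \<in> psd n" and T: "T \<in> psd n" and eq: "S * S = T * T"
  shows "S = T"
proof -
  define D where "D = S - T"
  have cS [simp]: "S \<in> carrier_mat n n" and cT [simp]: "T \<in> carrier_mat n n"
    using S T by (simp_all add: psd_carrier)
  then have cD [simp]: "D \<in> carrier_mat n n"
    by (simp add: D_def minus_carrier_mat)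
  have "mat_adjoint D $$ (i, j) = D $$ (i, j)" if "i < n" "j < n" for i j
    using that carrier_matD[OF cS] carrier_matD[OF cT] carrier_matD[OF cD]
      mat_adjoint_index[of i S j] mat_adjoint_index[of i T j]
    by (simp add: psd_hermitian[OF S] psd_hermitian[OF T]) (simp add: D_def)
  then have hD: "mat_adjoint D = D"
    using carrier_matD[OF cD] by (intro eq_matI) (auto simp del: mat_adjoint_index)
  have SD: "S * D + D * T = 0\<^sub>m n n"
  proof -
    have "S * D = S * S - S * T" "D * T = S * T - T * T"
      by (simp_all add: D_def mult_minus_distrib_mat[OF cS cS cT] minus_mult_distrib_mat[OF cS cT cT])
    then show ?thesis
      using carrier_matD[OF cS] carrier_matD[OF cT] by (intro eq_matI) (auto simp: eq)
  qed
  let ?s = "\<lambda>i. (S *\<^sub>v col D i) \<bullet>c col D i" and ?t = "\<lambda>i. (T *\<^sub>v col D i) \<bullet>c col D i"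
  \<comment> \<open>Cyclicity of the trace turns D T D into D D T, so that the two terms combine to
    D (S D + D T), which vanishes by \<open>SD\<close>.\<close>
  have "trace (D * (S * D)) + trace (D * (T * D)) = trace (D * (S * D)) + trace (D * (D * T))"
    using trace_mult_commute[of "D * T" n n D] by (simp add: assoc_mult_mat[OF cD cT cD])
  also have "\<dots> = trace (D * (S * D) + D * (D * T))"
    using carrier_matD[OF cD] carrier_matD[OF cT]
    by (simp add: trace_def sum.distrib del: index_mult_mat(1))
  also have "\<dots> = trace (D * (S * D + D * T))"
    by (simp add: mult_add_distrib_mat[OF cD mult_carrier_mat[OF cS cD] mult_carrier_mat[OF cD cT]])
  also have "\<dots> = 0"
    using carrier_matD[OF cD] by (simp add: SD trace_def)
  finally have "(\<Sum>i<n. ?s i + ?t i) = 0"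
    using carrier_matD[OF cD] carrier_matD[OF cS] carrier_matD[OF cT]
    by (simp add: trace_def mult_form_diag[OF cD hD cS] mult_form_diag[OF cD hD cT] sum.distrib
        del: index_mult_mat(1))
  moreover have nn: "0 \<le> ?s i" "0 \<le> ?t i" if "i < n" for i
    using that psd_form_nonneg[OF S, of "col D i"] psd_form_nonneg[OF T, of "col D i"] by auto
  ultimately have st: "?s i + ?t i = 0" if "i < n" for i
    using that sum_nonneg_eq_0_iff[of "{..<n}" "\<lambda>i. ?s i + ?t i"] by auto
  have 0: "?s i = 0" "?t i = 0" if "i < n" for i
    using st[OF that] nn[OF that] by (simp_all add: complex_eq_iff less_eq_complex_def)
  \<comment> \<open>S and T both annihilate the columns of D, hence so does D = S - T. Thus D D = 0,
    and since D is Hermitian this is D times its adjoint.\<close>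
  have "col (D * D) i = 0\<^sub>v n" if i: "i < n" for i
  proof -
    have "S *\<^sub>v col D i = 0\<^sub>v n" "T *\<^sub>v col D i = 0\<^sub>v n"
      using i 0 by (auto intro!: psd_form_eq_0[OF S] psd_form_eq_0[OF T])
    then have "D *\<^sub>v col D i = 0\<^sub>v n"
      using i minus_mult_distrib_mat_vec[OF cS cT, of "col D i"] by (simp add: D_def[symmetric])
    then show ?thesis
      using i by (simp add: col_mult2[of D n n D n])
  qed
  then have "D * D = 0\<^sub>m n n"
    using carrier_matD[OF cD] by (intro mat_col_eqI) (auto simp del: col_mult2)
  then have "D = 0\<^sub>m n n"
    using mult_adjoint_eq_0[OF cD] by (simp add: hD)
  then have "D $$ (i, j) = 0" if "i < n" "j < n" for i j
    using that by simp
  then show ?thesis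
    using carrier_matD[OF cS] carrier_matD[OF cT] by (intro eq_matI) (auto simp: D_def)
qed

section \<open>Evaluating the trace norm\<close>

text \<open>Since \<open>mat_sqrt\<close> is a definite description, uniqueness of the psd root
  means that exhibiting one root S evaluates it. All trace norms below are computed this way, with
  explicit roots.\<close>

lemma trace_norm_eqI:
  assumes A: "A \<in> carrier_mat n n" and S: "S \<in> psd n" and eq: "A * mat_adjoint A = S * S"
  shows "trace_norm A = Re (trace S)"
proof -
  have "mat_sqrt (A * mat_adjoint A) = S"
    unfolding mat_sqrt_def
  proof (rule the_equality)
    have dim: "dim_row (A * mat_adjoint A) = n"
      using A by simp
    show "S \<in> psd (dim_row (A * mat_adjoint A)) \<and> S * S = A * mat_adjoint A"
      using S eq by (metis dim)
    show "T = S" if "T \<in> psd (dim_row (A * mat_adjoint A)) \<and> T * T = A * mat_adjoint A" for T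
      using that S eq by (metis dim psd_sqrt_unique)
  qed
  then show ?thesis by (simp add: trace_norm_def)
qed


lemma form_expand:
  fixes A :: "complex mat"
  assumes "A \<in> carrier_mat n n" "v \<in> carrier_vec n"
  shows "(A *\<^sub>v v) \<bullet>c v = (\<Sum>i<n. \<Sum>j<n. A $$ (i, j) * v $ j * cnj (v $ i))"
  using assms by (simp add: scalar_prod_def atLeast0LessThan sum_distrib_right)

lemma psd_one: "1\<^sub>m n \<in> psd n"
  by (auto simp: psd_def intro: conjugate_square_ge_0_vec)

lemma psd_smult:
  assumes A: "A \<in> psd n" and c: "0 \<le> (c :: real)"
  shows "of_real c \<cdot>\<^sub>m A \<in> psd n"
proof -
  have "((of_real c \<cdot>\<^sub>m A) *\<^sub>v v) \<bullet>c v = of_real c * ((A *\<^sub>v v) \<bullet>c v)" if "v \<in> carrier_vec n" for v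
    using that psd_carrier[OF A]
    by (simp add: form_expand[of _ n] sum_distrib_left mult.assoc)
  then show ?thesis
    using psd_carrier[OF A] psd_form_nonneg[OF A] c
    by (auto simp: psd_def less_eq_complex_def)
qed

text \<open>The form at v is the squared norm of the adjoint of A applied to v; the proof is this
  identity, obtained by reordering the triple sum.\<close>

lemma psd_mult_adjoint:
  assumes A: "A \<in> carrier_mat n m"
  shows "A * mat_adjoint A \<in> psd n"
proof -
  have "((A * mat_adjoint A) *\<^sub>v v) \<bullet>c v = (mat_adjoint A *\<^sub>v v) \<bullet>c (mat_adjoint A *\<^sub>v v)"
    if v: "v \<in> carrier_vec n" for v
  proof -
    let ?f = "\<lambda>i j l. A $$ (i, l) * cnj (A $$ (j, l)) * v $ j * cnj (v $ i)"
    have "((A * mat_adjoint A) *\<^sub>v v) \<bullet>c v = (\<Sum>i<n. \<Sum>j<n. \<Sum>l<m. ?f i j l)"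
      using A v by (simp add: form_expand[of _ n] scalar_prod_def atLeast0LessThan sum_distrib_right)
    also have "\<dots> = (\<Sum>i<n. \<Sum>l<m. \<Sum>j<n. ?f i j l)"
      by (intro sum.cong refl sum.swap)
    also have "\<dots> = (\<Sum>l<m. \<Sum>i<n. \<Sum>j<n. ?f i j l)"
      by (rule sum.swap)
    also have "\<dots> = (\<Sum>l<m. \<Sum>j<n. \<Sum>i<n. ?f i j l)"
      by (intro sum.cong refl sum.swap)
    also have "\<dots> = (mat_adjoint A *\<^sub>v v) \<bullet>c (mat_adjoint A *\<^sub>v v)"
      using A v by (simp add: scalar_prod_def atLeast0LessThan sum_product mult_ac)
    finally show ?thesis .
  qed
  then show ?thesis
    using A conjugate_square_ge_0_vec by (auto simp: psd_def)
qed

section \<open>Kronecker products\<close>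

text \<open>Flat indices of a tensor product correspond to pairs through \<open>i div m\<close> and
  \<open>i mod m\<close>. Every sum over a Kronecker product is split by this rule.\<close>

lemma sum_div_mod:
  fixes f :: "nat \<Rightarrow> nat \<Rightarrow> 'a :: comm_monoid_add"
  shows "(\<Sum>i<n * m. f (i div m) (i mod m)) = (\<Sum>a<n. \<Sum>b<m. f a b)"
proof -
  have "(\<Sum>i<n * m. f (i div m) (i mod m)) = (\<Sum>a<n. \<Sum>i = a * m..<a * m + m. f (i div m) (i mod m))"
    by (rule sum.nat_group[symmetric])
  also have "\<dots> = (\<Sum>a<n. \<Sum>b<m. f a b)"
  proof (rule sum.cong[OF refl])
    fix a
    show "(\<Sum>i = a * m..<a * m + m. f (i div m) (i mod m)) = (\<Sum>b<m. f a b)"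
      using sum.shift_bounds_nat_ivl[of "\<lambda>i. f (i div m) (i mod m)" 0 "a * m" m]
      by (simp add: atLeast0LessThan add.commute)
  qed
  finally show ?thesis .
qed

lemma kronecker_carrier [simp]:
  "A \<in> carrier_mat n p \<Longrightarrow> B \<in> carrier_mat m r \<Longrightarrow> kronecker A B \<in> carrier_mat (n * m) (p * r)"
  by (auto simp: kronecker_def)

lemma kronecker_index:
  assumes "A \<in> carrier_mat n p" "B \<in> carrier_mat m r" "i < n * m" "j < p * r"
  shows "kronecker A B $$ (i, j) = A $$ (i div m, j div r) * B $$ (i mod m, j mod r)"
  using assms by (auto simp: kronecker_def)

lemma div_mod_less_mult:
  fixes i n m :: nat
  assumes "i < n * m"
  shows "i div m < n" "i mod m < m"
  using assms by (cases m; simp add: less_mult_imp_div_less)+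

lemma kronecker_mult:
  assumes A: "A \<in> carrier_mat n p" and C: "C \<in> carrier_mat p q"
    and B: "B \<in> carrier_mat m r" and D: "D \<in> carrier_mat r s"
  shows "kronecker A B * kronecker C D = kronecker (A * C) (B * D)"
proof (rule eq_matI)
  note AB = kronecker_carrier[OF A B] and CD = kronecker_carrier[OF C D]
  have AC: "A * C \<in> carrier_mat n q" and BD: "B * D \<in> carrier_mat m s"
    using A B C D by auto
  note ACBD = kronecker_carrier[OF AC BD]
  fix i j
  assume "i < dim_row (kronecker (A * C) (B * D))" "j < dim_col (kronecker (A * C) (B * D))"
  then have ij: "i < n * m" "j < q * s"
    using ACBD by auto
  have "(kronecker A B * kronecker C D) $$ (i, j) = (\<Sum>l<p * r. kronecker A B $$ (i, l) * kronecker C D $$ (l, j))"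
    using ij AB CD by (simp add: scalar_prod_def atLeast0LessThan)
  also have "\<dots> = (\<Sum>l<p * r. (A $$ (i div m, l div r) * C $$ (l div r, j div s))
      * (B $$ (i mod m, l mod r) * D $$ (l mod r, j mod s)))"
    using ij by (intro sum.cong refl) (simp add: kronecker_index[OF A B] kronecker_index[OF C D])
  also have "\<dots> = (\<Sum>a<p. A $$ (i div m, a) * C $$ (a, j div s)) * (\<Sum>b<r. B $$ (i mod m, b) * D $$ (b, j mod s))"
    by (subst sum_div_mod[of "\<lambda>a b. (A $$ (i div m, a) * C $$ (a, j div s))
      * (B $$ (i mod m, b) * D $$ (b, j mod s))"]) (simp add: sum_product)
  also have "\<dots> = kronecker (A * C) (B * D) $$ (i, j)"
    unfolding kronecker_index[OF AC BD ij]
    using A B C D div_mod_less_mult[OF ij(1)] div_mod_less_mult[OF ij(2)]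
    by (simp add: scalar_prod_def atLeast0LessThan)
  finally show "(kronecker A B * kronecker C D) $$ (i, j) = kronecker (A * C) (B * D) $$ (i, j)" .
qed (use A B C D in \<open>auto simp: kronecker_def\<close>)

lemma mat_adjoint_kronecker:
  assumes A: "A \<in> carrier_mat n p" and B: "B \<in> carrier_mat m r"
  shows "mat_adjoint (kronecker A B) = kronecker (mat_adjoint A) (mat_adjoint B)"
proof (rule eq_matI)
  fix i j
  assume "i < dim_row (kronecker (mat_adjoint A) (mat_adjoint B))"
    "j < dim_col (kronecker (mat_adjoint A) (mat_adjoint B))"
  then have ij: "i < p * r" "j < n * m"
    using A B by (auto simp: kronecker_def)
  then show "mat_adjoint (kronecker A B) $$ (i, j) = kronecker (mat_adjoint A) (mat_adjoint B) $$ (i, j)"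
    using A B carrier_matD[OF kronecker_carrier[OF A B]] div_mod_less_mult[OF ij(1)] div_mod_less_mult[OF ij(2)]
      mat_adjoint_index[of i "kronecker A B" j]
    by (simp add: kronecker_index[OF A B] kronecker_index[OF mat_adjoint_carrier[OF A] mat_adjoint_carrier[OF B]])
qed (use A B in \<open>auto simp: kronecker_def\<close>)

lemma trace_kronecker:
  assumes A: "A \<in> carrier_mat n n" and B: "B \<in> carrier_mat m m"
  shows "trace (kronecker A B) = trace A * trace B"
proof -
  have "trace (kronecker A B) = (\<Sum>i<n * m. A $$ (i div m, i div m) * B $$ (i mod m, i mod m))"
    using kronecker_carrier[OF A B] by (simp add: trace_def kronecker_index[OF A B])
  also have "\<dots> = trace A * trace B"
    using A B by (simp add: sum_div_mod[of "\<lambda>a b. A $$ (a, a) * B $$ (b, b)"] sum_product trace_def)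
  finally show ?thesis .
qed

text \<open>Slice v into vectors \<open>w b\<close> by the second tensor index b. The identity
  factor couples no two different slices, so the form is the sum over b of the form of P at
  \<open>w b\<close>.\<close>

lemma psd_kronecker_one:
  assumes P: "P \<in> psd k"
  shows "kronecker P (1\<^sub>m m) \<in> psd (k * m)"
proof -
  have c: "P \<in> carrier_mat k k"
    using P by (rule psd_carrier)
  note K = kronecker_carrier[OF c one_carrier_mat[of m]]
  have "0 \<le> (kronecker P (1\<^sub>m m) *\<^sub>v v) \<bullet>c v" if v: "v \<in> carrier_vec (k * m)" for v
  proof -
    define w where "w b = vec k (\<lambda>a. v $ (a * m + b))" for b
    have v': "v $ i = w (i mod m) $ (i div m)" if "i < k * m" for i
      using div_mod_less_mult[OF that] by (simp add: w_def)
    have "(kronecker P (1\<^sub>m m) *\<^sub>v v) \<bullet>c v =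
      (\<Sum>i<k * m. \<Sum>j<k * m. P $$ (i div m, j div m) * 1\<^sub>m m $$ (i mod m, j mod m)
          * w (j mod m) $ (j div m) * cnj (w (i mod m) $ (i div m)))"
      unfolding form_expand[OF K v]
      by (intro sum.cong refl) (simp add: kronecker_index[OF c one_carrier_mat] v' del: index_one_mat(1))
    also have "\<dots> = (\<Sum>a<k. \<Sum>b<m. \<Sum>a'<k. \<Sum>b'<m. P $$ (a, a') * 1\<^sub>m m $$ (b, b') * w b' $ a' * cnj (w b $ a))"
      by (simp only: sum_div_mod[of "\<lambda>a' b'. P $$ (i div m, a') * 1\<^sub>m m $$ (i mod m, b')
          * w b' $ a' * cnj (w (i mod m) $ (i div m))" for i]
        sum_div_mod[of "\<lambda>a b. \<Sum>a'<k. \<Sum>b'<m. P $$ (a, a') * 1\<^sub>m m $$ (b, b') * w b' $ a' * cnj (w b $ a)"])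
    also have "\<dots> = (\<Sum>a<k. \<Sum>b<m. \<Sum>a'<k. P $$ (a, a') * w b $ a' * cnj (w b $ a))"
    proof (intro sum.cong refl)
      fix a b a'
      assume "b \<in> {..<m}"
      then have "(\<Sum>b'<m. P $$ (a, a') * 1\<^sub>m m $$ (b, b') * w b' $ a' * cnj (w b $ a)) =
          (\<Sum>b'<m. if b = b' then P $$ (a, a') * w b $ a' * cnj (w b $ a) else 0)"
        by (intro sum.cong) auto
      then show "(\<Sum>b'<m. P $$ (a, a') * 1\<^sub>m m $$ (b, b') * w b' $ a' * cnj (w b $ a)) =
          P $$ (a, a') * w b $ a' * cnj (w b $ a)"
        using \<open>b \<in> {..<m}\<close> by simp
    qed
    also have "\<dots> = (\<Sum>b<m. \<Sum>a<k. \<Sum>a'<k. P $$ (a, a') * w b $ a' * cnj (w b $ a))"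
      by (rule sum.swap)
    also have "\<dots> = (\<Sum>b<m. (P *\<^sub>v w b) \<bullet>c w b)"
      by (intro sum.cong refl) (simp add: form_expand[OF c] w_def)
    finally show ?thesis
      by (simp add: sum_nonneg psd_form_nonneg[OF P] w_def)
  qed
  then show ?thesis
    using K by (simp add: psd_def)
qed

text \<open>Here B is c times a unitary, so the product with the adjoint is c^2 times the Kronecker
  product of P P with the identity. Its psd root is c times the Kronecker product of P with the
  identity, whose trace is c m tr P.\<close>

lemma trace_norm_kronecker:
  assumes P: "P \<in> psd k" and B: "B \<in> carrier_mat m m" and c: "0 \<le> c"
    and BB: "B * mat_adjoint B = of_real (c\<^sup>2) \<cdot>\<^sub>m 1\<^sub>m m"
  shows "trace_norm (kronecker P B) = c * m * Re (trace P)"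
proof -
  have cP: "P \<in> carrier_mat k k"
    using P by (rule psd_carrier)
  note K = kronecker_carrier[OF cP one_carrier_mat[of m]]
  have "kronecker P B * mat_adjoint (kronecker P B) = kronecker (P * P) (of_real (c\<^sup>2) \<cdot>\<^sub>m 1\<^sub>m m)"
    by (simp add: mat_adjoint_kronecker[OF cP B] psd_hermitian[OF P] kronecker_mult[OF cP cP B mat_adjoint_carrier[OF B]] BB)
  also have "\<dots> = of_real (c\<^sup>2) \<cdot>\<^sub>m kronecker (P * P) (1\<^sub>m m)"
    using cP div_mod_less_mult by (intro eq_matI) (auto simp: kronecker_def)
  also have "\<dots> = of_real (c\<^sup>2) \<cdot>\<^sub>m (kronecker P (1\<^sub>m m) * kronecker P (1\<^sub>m m))"
    by (simp add: kronecker_mult[OF cP cP one_carrier_mat one_carrier_mat])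
  also have "\<dots> = (of_real c \<cdot>\<^sub>m kronecker P (1\<^sub>m m)) * (of_real c \<cdot>\<^sub>m kronecker P (1\<^sub>m m))"
    using K by (intro eq_matI) (auto simp: power2_eq_square mult.assoc)
  finally have "trace_norm (kronecker P B) = Re (trace (of_real c \<cdot>\<^sub>m kronecker P (1\<^sub>m m)))"
    using kronecker_carrier[OF cP B] psd_smult[OF psd_kronecker_one[OF P] c] by (rule trace_norm_eqI[rotated 2])
  also have "\<dots> = c * Re (trace (kronecker P (1\<^sub>m m)))"
    using K by (simp add: trace_def flip: sum_distrib_left)
  also have "\<dots> = c * m * Re (trace P)"
    unfolding trace_kronecker[OF cP one_carrier_mat] by (simp add: trace_def)
  finally show ?thesis .
qed


section \<open>Bloch maps\<close>

lemmas sigma_defs = sigma_x_def sigma_y_def sigma_z_def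

lemma pauli_combination_mat:
  "(1 / 2) \<cdot>\<^sub>m (p \<cdot>\<^sub>m 1\<^sub>m 2 + q \<cdot>\<^sub>m sigma_x + r \<cdot>\<^sub>m sigma_y + s \<cdot>\<^sub>m sigma_z) =
    mat 2 2 (\<lambda>(i, j). if i = 0 then if j = 0 then (p + s) / 2 else (q - \<i> * r) / 2
      else if j = 0 then (q + \<i> * r) / 2 else (p - s) / 2)"
  by (rule eq_matI) (auto simp: sigma_defs mat_of_rows_list_def numeral_2_eq_2 less_Suc_eq)

lemma bloch_map_carrier [simp]: "bloch_map a b c t X \<in> carrier_mat 2 2"
  unfolding bloch_map_def pauli_combination_mat by simp

text \<open>Orthogonality of the Pauli matrices under the trace. It lets Pauli coordinates be read
  off the output of a Bloch map, which is what makes composition a computation with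
  coefficients.\<close>

lemma trace_pauli_combination:
  fixes p q r s :: complex
  defines "M \<equiv> (1 / 2) \<cdot>\<^sub>m (p \<cdot>\<^sub>m 1\<^sub>m 2 + q \<cdot>\<^sub>m sigma_x + r \<cdot>\<^sub>m sigma_y + s \<cdot>\<^sub>m sigma_z)"
  shows "trace M = p" "trace (sigma_x * M) = q" "trace (sigma_y * M) = r" "trace (sigma_z * M) = s"
  unfolding M_def pauli_combination_mat
  by (simp_all add: sigma_defs two_by_two)
    (simp_all add: algebra_simps flip: add_divide_distrib diff_divide_distrib)

lemma bloch_map_comp:
  "bloch_map a b c t (bloch_map a' b' c' t' X) =
    bloch_map (a * a') (b * b') (c * c') (t + c * t') X"
  unfolding bloch_map_def trace_pauli_combination by (simp add: algebra_simps)

text \<open>\<open>sigma_x\<close> anticommutes with \<open>sigma_y\<close> and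
  \<open>sigma_z\<close>, so conjugation by it flips the signs of the y and z coordinates.\<close>

lemma unitary_channel_sigma_x:
  assumes "X \<in> carrier_mat 2 2"
  shows "unitary_channel sigma_x X = bloch_map 1 (- 1) (- 1) 0 X"
proof -
  have "mat_adjoint sigma_x = sigma_x"
    by (rule eq_matI) (auto simp: sigma_x_def mat_of_rows_list_def less_Suc_eq numeral_2_eq_2)
  then show ?thesis
    using assms
    by (intro eq_matI)
      (auto simp: unitary_channel_def bloch_map_def sigma_defs two_by_two less_Suc_eq
        complex_eq_iff algebra_simps)
qed

text \<open>Nothing is assumed of X, so this applies to the blocks of a larger state, which need not
  be Hermitian.\<close>

lemma bloch_map_shift_diff:
  "bloch_map a b c t X - bloch_map a b c 0 X = (of_real (t / 2) * trace X) \<cdot>\<^sub>m sigma_z"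
  unfolding bloch_map_def pauli_combination_mat
  by (rule eq_matI)
    (auto simp: sigma_z_def mat_of_rows_list_def numeral_2_eq_2 less_Suc_eq
      simp flip: add_divide_distrib diff_divide_distrib)

lemma bloch_state_mat:
  "bloch_state x y z = mat 2 2 (\<lambda>(i, j). if i = 0 then if j = 0 then (1 + of_real z) / 2 else Complex (x / 2) (- y / 2)
    else if j = 0 then Complex (x / 2) (y / 2) else (1 - of_real z) / 2)"
  by (rule eq_matI)
    (auto simp: bloch_state_def sigma_defs two_by_two less_Suc_eq field_simps complex_eq_iff)

lemma bloch_state_carrier [simp]: "bloch_state x y z \<in> carrier_mat 2 2"
  by (simp add: bloch_state_mat)

text \<open>On the unit sphere the state is a projection, so it equals its product with its own
  adjoint and is psd.\<close>

lemma bloch_state_pure_density: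
  assumes "x\<^sup>2 + y\<^sup>2 + z\<^sup>2 = 1"
  shows "bloch_state x y z \<in> density 2"
proof -
  have x: "x * x = 1 - y * y - z * z"
    using assms by (simp add: power2_eq_square)
  have "bloch_state x y z = bloch_state x y z * mat_adjoint (bloch_state x y z)"
    by (rule eq_matI)
      (auto simp: bloch_state_mat mat_adjoint_eq_mat two_by_two less_Suc_eq field_simps
        complex_eq_iff x)
  then have "bloch_state x y z \<in> psd 2"
    using psd_mult_adjoint[OF bloch_state_carrier] by metis
  moreover have "trace (bloch_state x y z) = 1"
    by (simp add: bloch_state_mat two_by_two field_simps)
  ultimately show ?thesis
    by (simp add: density_def)
qed

text \<open>For a difference v of Bloch vectors the matrix is half of the Pauli combination of v,
  whose square is |v|^2 / 4 times the identity. The root is |v| / 2 times the identity, of trace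
  |v|.\<close>

lemma trace_norm_bloch_state_diff:
  "trace_norm (bloch_state x y z - bloch_state x' y' z') =
    sqrt ((x - x')\<^sup>2 + (y - y')\<^sup>2 + (z - z')\<^sup>2)" (is "trace_norm ?A = ?r")
proof -
  have r: "?r * ?r = (x - x') * (x - x') + (y - y') * (y - y') + (z - z') * (z - z')"
    by (simp add: power2_eq_square)
  have "?A * mat_adjoint ?A = (of_real (?r / 2) * of_real (?r / 2)) \<cdot>\<^sub>m 1\<^sub>m 2"
    unfolding of_real_mult[symmetric] times_divide_times_eq r
    by (rule eq_matI)
      (auto simp: bloch_state_mat mat_adjoint_eq_mat two_by_two less_Suc_eq field_simps
        complex_eq_iff)
  also have "\<dots> = (of_real (?r / 2) \<cdot>\<^sub>m 1\<^sub>m 2) * (of_real (?r / 2) \<cdot>\<^sub>m 1\<^sub>m 2)"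
    by (intro eq_matI) auto
  finally have "trace_norm ?A = Re (trace (of_real (?r / 2) \<cdot>\<^sub>m 1\<^sub>m 2))"
    by (intro trace_norm_eqI[of _ 2] psd_smult psd_one minus_carrier_mat) auto
  then show ?thesis
    by (simp add: trace_def)
qed

section \<open>Distances\<close>

lemma same_channel_trace_dist:
  assumes "same_channel E E'" "same_channel F F'"
  shows "trace_dist E F = trace_dist E' F'"
  using assms psd_carrier
  unfolding trace_dist_def same_channel_def density_def by (intro SUP_cong) auto

lemma same_channel_diamond_dist:
  assumes "same_channel E E'" "same_channel F F'"
  shows "diamond_dist E F = diamond_dist E' F'"
proof -
  have "id_tensor k E = id_tensor k E'" "id_tensor k F = id_tensor k F'" for k
    using assms by (auto simp: id_tensor_def same_channel_def block_def)
  then show ?thesis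
    by (simp add: diamond_dist_def)
qed

text \<open>An ancilla of dimension 1 gives back the trace distance. The carrier hypotheses are used
  because \<open>id_tensor\<close> rebuilds its result as a matrix of size 2.\<close>

lemma trace_dist_le_diamond_dist:
  assumes E: "\<And>X. E X \<in> carrier_mat 2 2" and F: "\<And>X. F X \<in> carrier_mat 2 2"
  shows "trace_dist E F \<le> diamond_dist E F"
proof -
  have id: "id_tensor 1 G \<rho> = G \<rho>"
    if "\<rho> \<in> carrier_mat 2 2" "\<And>X. G X \<in> carrier_mat 2 2" for G \<rho>
  proof -
    have "block \<rho> 0 0 = \<rho>"
      using that(1) by (intro eq_matI) (auto simp: block_def)
    then show ?thesis
      using that(2)[of \<rho>] by (intro eq_matI) (auto simp: id_tensor_def)
  qed
  have "trace_dist E F = (SUP \<rho> \<in> density (2 * 1). ereal (trace_norm (id_tensor 1 E \<rho> - id_tensor 1 F \<rho>)))"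
    unfolding trace_dist_def
    using id[OF _ E] id[OF _ F] by (intro SUP_cong) (auto simp: density_def psd_def)
  also have "\<dots> \<le> diamond_dist E F"
    unfolding diamond_dist_def by (rule SUP_upper) simp
  finally show ?thesis .
qed

lemma trace_dist_ge_bloch:
  assumes "x\<^sup>2 + y\<^sup>2 + z\<^sup>2 = 1"
  shows "ereal (sqrt (((a - a') * x)\<^sup>2 + ((b - b') * y)\<^sup>2 + (t + (c - c') * z)\<^sup>2))
    \<le> trace_dist (bloch_map a b c t) (bloch_map a' b' c' 0)"
proof -
  have "sqrt (((a - a') * x)\<^sup>2 + ((b - b') * y)\<^sup>2 + (t + (c - c') * z)\<^sup>2) =
      trace_norm (bloch_map a b c t (bloch_state x y z) - bloch_map a' b' c' 0 (bloch_state x y z))"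
    unfolding bloch_map_bloch_state trace_norm_bloch_state_diff by (simp add: algebra_simps)
  then show ?thesis
    unfolding trace_dist_def using bloch_state_pure_density[OF assms] by (metis (lifting) SUP_upper)
qed

text \<open>The two poles of the Bloch sphere give |t + e| and |t - e| with e = c - c'. These cannot
  both be smaller than |t|.\<close>

lemma trace_dist_bloch_map_ge:
  "ereal \<bar>t\<bar> \<le> trace_dist (bloch_map a b c t) (bloch_map a' b' c' 0)"
proof -
  let ?d = "trace_dist (bloch_map a b c t) (bloch_map a' b' c' 0)"
  have "ereal \<bar>t + (c - c')\<bar> \<le> ?d" "ereal \<bar>t + (c' - c)\<bar> \<le> ?d"
    using trace_dist_ge_bloch[of 0 0 1 a a' b b' t c c'] trace_dist_ge_bloch[of 0 0 "- 1" a a' b b' t c c']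
    by simp_all
  moreover have "\<bar>t\<bar> \<le> \<bar>t + (c - c')\<bar> \<or> \<bar>t\<bar> \<le> \<bar>t + (c' - c)\<bar>"
    by linarith
  ultimately show ?thesis
    by (meson ereal_less_eq(3) order_trans)
qed

text \<open>Adding the bounds at the two poles gives 2 t^2 + 2 (c - c')^2 \<le> 2 t^2, so c' = c. At
  the points on the x and y axes the z difference is exactly t, which leaves no room for a
  difference in a or b.\<close>

lemma trace_dist_bloch_map_le_imp_eq:
  assumes le: "trace_dist (bloch_map a b c t) (bloch_map a' b' c' 0) \<le> ereal \<bar>t\<bar>"
  shows "a' = a" "b' = b" "c' = c"
proof -
  have *: "((a - a') * x)\<^sup>2 + ((b - b') * y)\<^sup>2 + (t + (c - c') * z)\<^sup>2 \<le> t\<^sup>2"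
    if "x\<^sup>2 + y\<^sup>2 + z\<^sup>2 = 1" for x y z
  proof -
    have "sqrt (((a - a') * x)\<^sup>2 + ((b - b') * y)\<^sup>2 + (t + (c - c') * z)\<^sup>2) \<le> sqrt (t\<^sup>2)"
      using order_trans[OF trace_dist_ge_bloch[OF that] le] by simp
    then show ?thesis
      by (simp only: real_sqrt_le_iff)
  qed
  have "(c - c')\<^sup>2 \<le> 0"
    using *[of 0 0 1] *[of 0 0 "- 1"] by (simp add: power2_eq_square algebra_simps)
  then show "c' = c" by simp
  show "a' = a" "b' = b"
    using *[of 1 0 0] *[of 0 1 0] by simp_all
qed

section \<open>The reduced state of the ancilla\<close>

text \<open>The qubit factor is traced out and the ancilla is kept.\<close>

definition ptrace :: "nat \<Rightarrow> complex mat \<Rightarrow> complex mat" where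
  "ptrace k R = mat k k (\<lambda>(a, a'). trace (block R a a'))"

text \<open>The form of the reduced matrix at v is the sum, over the two basis vectors of the qubit,
  of the form of R at v tensored with that basis vector.\<close>

lemma ptrace_psd:
  assumes R: "R \<in> psd (2 * k)"
  shows "ptrace k R \<in> psd k"
proof -
  have c: "R \<in> carrier_mat (k * 2) (k * 2)"
    using psd_carrier[OF R] by (simp add: mult.commute)
  have "0 \<le> (ptrace k R *\<^sub>v v) \<bullet>c v" if v: "v \<in> carrier_vec k" for v
  proof -
    \<comment> \<open>\<open>w b\<close> is v tensored with the basis vector b of the qubit.\<close>
    define w where "w b = vec (k * 2) (\<lambda>i. if i mod 2 = b then v $ (i div 2) else 0)" for b
    have form: "(R *\<^sub>v w b) \<bullet>c w b =
        (\<Sum>a<k. \<Sum>a'<k. R $$ (2 * a + b, 2 * a' + b) * v $ a' * cnj (v $ a))" if b: "b < 2" for b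
    proof -
      define g where "g a e = (if e = b then v $ a else 0)" for a e
      have w: "w b $ i = g (i div 2) (i mod 2)" if "i < k * 2" for i
        using that by (simp add: w_def g_def)
      have wc: "w b \<in> carrier_vec (k * 2)"
        by (simp add: w_def)
      \<comment> \<open>Writing each index as \<open>2 * (i div 2) + i mod 2\<close> makes the
        summand a function of the quotient and the remainder, as \<open>sum_div_mod\<close>
        requires.\<close>
      have "(R *\<^sub>v w b) \<bullet>c w b = (\<Sum>i<k * 2. \<Sum>j<k * 2.
          R $$ (2 * (i div 2) + i mod 2, 2 * (j div 2) + j mod 2) * g (j div 2) (j mod 2) * cnj (g (i div 2) (i mod 2)))"
        unfolding form_expand[OF c wc] by (intro sum.cong refl) (simp add: w)
      also have "\<dots> = (\<Sum>a<k. \<Sum>e<2. \<Sum>a'<k. \<Sum>e'<2. R $$ (2 * a + e, 2 * a' + e') * g a' e' * cnj (g a e))"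
        by (simp only: sum_div_mod[of "\<lambda>a' e'. R $$ (2 * (i div 2) + i mod 2, 2 * a' + e') * g a' e'
            * cnj (g (i div 2) (i mod 2))" for i]
          sum_div_mod[of "\<lambda>a e. \<Sum>a'<k. \<Sum>e'<2. R $$ (2 * a + e, 2 * a' + e') * g a' e' * cnj (g a e)"])
      also have "\<dots> = (\<Sum>a<k. \<Sum>a'<k. R $$ (2 * a + b, 2 * a' + b) * v $ a' * cnj (v $ a))"
        using b less_2_cases[OF b] by (elim disjE) (simp_all add: g_def numeral_2_eq_2)
      finally show ?thesis .
    qed
    have pc: "ptrace k R \<in> carrier_mat k k"
      by (simp add: ptrace_def)
    have "(ptrace k R *\<^sub>v v) \<bullet>c v =
        (\<Sum>a<k. \<Sum>a'<k. \<Sum>b<2. R $$ (2 * a + b, 2 * a' + b) * v $ a' * cnj (v $ a))"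
      unfolding form_expand[OF pc v]
      by (intro sum.cong refl) (simp add: ptrace_def block_def trace_def sum_distrib_right)
    also have "\<dots> = (\<Sum>a<k. \<Sum>b<2. \<Sum>a'<k. R $$ (2 * a + b, 2 * a' + b) * v $ a' * cnj (v $ a))"
      by (intro sum.cong refl sum.swap)
    also have "\<dots> = (\<Sum>b<2. (R *\<^sub>v w b) \<bullet>c w b)"
      by (subst sum.swap) (simp add: form)
    finally have "(ptrace k R *\<^sub>v v) \<bullet>c v = (\<Sum>b<2. (R *\<^sub>v w b) \<bullet>c w b)" .
    moreover have "w b \<in> carrier_vec (2 * k)" for b
      by (simp add: w_def mult.commute)
    ultimately show ?thesis
      by (simp add: sum_nonneg psd_form_nonneg[OF R])
  qed
  then show ?thesis
    by (simp add: psd_def ptrace_def)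
qed

lemma trace_ptrace:
  assumes "R \<in> carrier_mat (2 * k) (2 * k)"
  shows "trace (ptrace k R) = trace R"
proof -
  have "trace R = (\<Sum>i<k * 2. R $$ (2 * (i div 2) + i mod 2, 2 * (i div 2) + i mod 2))"
    using assms by (simp add: trace_def mult.commute)
  also have "\<dots> = trace (ptrace k R)"
    by (simp only: sum_div_mod[of "\<lambda>a b. R $$ (2 * a + b, 2 * a + b)"])
      (simp add: trace_def ptrace_def block_def)
  finally show ?thesis ..
qed

text \<open>The value is the same for every input. Since \<open>sigma_z\<close> squares to the
  identity, \<open>trace_norm_kronecker\<close> applies with c = |t / 2| and m = 2, and the reduced
  state has trace 1.\<close>

lemma trace_norm_bloch_map_shift:
  assumes \<rho>: "\<rho> \<in> density (2 * k)"
  shows "trace_norm (id_tensor k (bloch_map a b c t) \<rho> - id_tensor k (bloch_map a b c 0) \<rho>) = \<bar>t\<bar>"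
proof -
  have R: "\<rho> \<in> psd (2 * k)" and tr: "trace \<rho> = 1"
    using \<rho> by (auto simp: density_def)
  have diff: "id_tensor k (bloch_map a b c t) \<rho> - id_tensor k (bloch_map a b c 0) \<rho> =
      kronecker (ptrace k \<rho>) (of_real (t / 2) \<cdot>\<^sub>m sigma_z)"
  proof (rule eq_matI)
    fix i j
    assume "i < dim_row (kronecker (ptrace k \<rho>) (of_real (t / 2) \<cdot>\<^sub>m sigma_z))"
      "j < dim_col (kronecker (ptrace k \<rho>) (of_real (t / 2) \<cdot>\<^sub>m sigma_z))"
    then have ij: "i < 2 * k" "j < 2 * k"
      by (auto simp: kronecker_def ptrace_def sigma_z_def mat_of_rows_list_def)
    let ?X = "block \<rho> (i div 2) (j div 2)"
    have "(id_tensor k (bloch_map a b c t) \<rho> - id_tensor k (bloch_map a b c 0) \<rho>) $$ (i, j) =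
        (bloch_map a b c t ?X - bloch_map a b c 0 ?X) $$ (i mod 2, j mod 2)"
      using ij carrier_matD[OF bloch_map_carrier] by (simp add: id_tensor_def)
    also have "\<dots> = kronecker (ptrace k \<rho>) (of_real (t / 2) \<cdot>\<^sub>m sigma_z) $$ (i, j)"
      unfolding bloch_map_shift_diff using ij carrier_matD[OF sigma_carrier(3)]
      by (simp add: kronecker_def ptrace_def)
    finally show "(id_tensor k (bloch_map a b c t) \<rho> - id_tensor k (bloch_map a b c 0) \<rho>) $$ (i, j) =
        kronecker (ptrace k \<rho>) (of_real (t / 2) \<cdot>\<^sub>m sigma_z) $$ (i, j)" .
  qed (auto simp: id_tensor_def kronecker_def ptrace_def sigma_z_def mat_of_rows_list_def)
  have sq: "(of_real (t / 2) \<cdot>\<^sub>m sigma_z) * mat_adjoint (of_real (t / 2) \<cdot>\<^sub>m sigma_z) =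
      of_real (\<bar>t / 2\<bar>\<^sup>2) \<cdot>\<^sub>m 1\<^sub>m 2"
    by (rule eq_matI)
      (auto simp: sigma_z_def mat_adjoint_eq_mat two_by_two less_Suc_eq power2_eq_square)
  have "trace_norm (kronecker (ptrace k \<rho>) (of_real (t / 2) \<cdot>\<^sub>m sigma_z)) =
      \<bar>t / 2\<bar> * real 2 * Re (trace (ptrace k \<rho>))"
    by (rule trace_norm_kronecker[OF ptrace_psd[OF R] _ _ sq]) simp_all
  then show ?thesis
    unfolding diff by (simp add: trace_ptrace[OF psd_carrier[OF R]] tr)
qed

lemma diamond_dist_bloch_map_shift:
  "diamond_dist (bloch_map a b c t) (bloch_map a b c 0) = ereal \<bar>t\<bar>"
proof (rule antisym)
  show "diamond_dist (bloch_map a b c t) (bloch_map a b c 0) \<le> ereal \<bar>t\<bar>"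
    unfolding diamond_dist_def
    by (rule SUP_least, rule SUP_least) (simp only: trace_norm_bloch_map_shift order_refl)
  show "ereal \<bar>t\<bar> \<le> diamond_dist (bloch_map a b c t) (bloch_map a b c 0)"
    using trace_dist_bloch_map_ge trace_dist_le_diamond_dist[OF bloch_map_carrier bloch_map_carrier]
    by (rule order_trans)
qed

section \<open>Pauli parameters and the tetrahedron\<close>

text \<open>The two absolute values encode the four facets, one for each probability being
  nonnegative.\<close>

lemma tetrahedron_iff_ineqs:
  "(c1, c2, c3) \<in> tetrahedron \<longleftrightarrow> \<bar>c1 - c2\<bar> \<le> 1 + c3 \<and> \<bar>c1 + c2\<bar> \<le> 1 - c3"
proof
  assume "(c1, c2, c3) \<in> tetrahedron"
  then show "\<bar>c1 - c2\<bar> \<le> 1 + c3 \<and> \<bar>c1 + c2\<bar> \<le> 1 - c3"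
    unfolding tetrahedron_iff by (elim exE conjE) linarith
next
  assume "\<bar>c1 - c2\<bar> \<le> 1 + c3 \<and> \<bar>c1 + c2\<bar> \<le> 1 - c3"
  then show "(c1, c2, c3) \<in> tetrahedron"
    unfolding tetrahedron_iff
    \<comment> \<open>These probabilities solve the linear system that expresses the parameters and
      the total mass 1.\<close>
    by (intro exI[of _ "(1 + c1 - c2 + c3) / 4"] exI[of _ "(1 + c1 + c2 - c3) / 4"]
      exI[of _ "(1 - c1 - c2 - c3) / 4"] exI[of _ "(1 - c1 + c2 + c3) / 4"])
      (auto simp: field_simps)
qed

text \<open>The scaling is that of amplitude damping with its shift removed, s being
  \<open>sqrt (1 - \<eta>)\<close>. The facet bounds survive because 1 + s^2 q3 - s (1 + q3) = (1 -
  s) (1 - s q3) \<ge> 0, and likewise with the sign of q3 reversed.\<close>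

lemma tetrahedron_scale:
  assumes q: "(q1, q2, q3) \<in> tetrahedron" and s: "0 \<le> s" "s \<le> 1"
  shows "(s * q1, s * q2, s\<^sup>2 * q3) \<in> tetrahedron"
proof -
  have q': "\<bar>q1 - q2\<bar> \<le> 1 + q3" "\<bar>q1 + q2\<bar> \<le> 1 - q3"
    using q by (auto simp: tetrahedron_iff_ineqs)
  then have q3: "\<bar>q3\<bar> \<le> 1"
    by linarith
  have sq: "\<bar>s * q3\<bar> \<le> 1"
    using mult_mono[OF s(2) q3] s by (simp add: abs_mult)
  have "s * \<bar>q1 - q2\<bar> \<le> s * (1 + q3)" "s * \<bar>q1 + q2\<bar> \<le> s * (1 - q3)"
    using q' s by (simp_all add: mult_left_mono)
  moreover have "0 \<le> (1 - s) * (1 - s * q3)" "0 \<le> (1 - s) * (1 + s * q3)"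
    using s sq by (simp_all add: abs_le_iff)
  moreover have "\<bar>s * q1 - s * q2\<bar> = s * \<bar>q1 - q2\<bar>" "\<bar>s * q1 + s * q2\<bar> = s * \<bar>q1 + q2\<bar>"
    using s by (simp_all add: abs_mult flip: right_diff_distrib distrib_left)
  ultimately show ?thesis
    unfolding tetrahedron_iff_ineqs by (simp add: power2_eq_square algebra_simps)
qed

section \<open>The minimisation problem\<close>

text \<open>The distance d is abstract so that one argument serves both norms. Domination of the
  trace distance transfers its lower bound |t| and the uniqueness in the equality case to d; the
  upper bound says that the candidate attains |t|.\<close>

lemma closest_pauli_bloch_map:
  assumes E: "same_channel E (bloch_map a b c t)" and P: "bloch_map a b c 0 \<in> pauli_channels"
    and cong: "\<And>E E' F F'. same_channel E E' \<Longrightarrow> same_channel F F' \<Longrightarrow> d E F = d E' F'"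
    and lower: "\<And>a' b' c'. trace_dist (bloch_map a b c t) (bloch_map a' b' c' 0)
      \<le> d (bloch_map a b c t) (bloch_map a' b' c' 0)"
    and upper: "d (bloch_map a b c t) (bloch_map a b c 0) \<le> ereal \<bar>t\<bar>"
  shows "closest_pauli d E C \<longleftrightarrow> same_channel C (bloch_map a b c 0)"
proof -
  have bloch: "\<exists>a' b' c'. same_channel F (bloch_map a' b' c' 0)" if "F \<in> pauli_channels" for F
    using that unfolding pauli_channels_iff pauli_map_def by blast
  have pauli: "F \<in> pauli_channels" if "same_channel F (bloch_map a b c 0)" for F
    using P that unfolding pauli_channels_def same_channel_def by auto
  have ge: "ereal \<bar>t\<bar> \<le> d E F" if F: "F \<in> pauli_channels" for F
  proof -
    obtain a' b' c' where "same_channel F (bloch_map a' b' c' 0)"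
      using bloch[OF F] by blast
    then show ?thesis
      using cong[OF E] order_trans[OF trace_dist_bloch_map_ge lower] by simp
  qed
  have eq: "d E F \<le> ereal \<bar>t\<bar> \<longleftrightarrow> same_channel F (bloch_map a b c 0)" if F: "F \<in> pauli_channels" for F
  proof
    obtain a' b' c' where F': "same_channel F (bloch_map a' b' c' 0)"
      using bloch[OF F] by blast
    assume "d E F \<le> ereal \<bar>t\<bar>"
    then have "trace_dist (bloch_map a b c t) (bloch_map a' b' c' 0) \<le> ereal \<bar>t\<bar>"
      using cong[OF E F'] order_trans[OF lower] by simp
    then show "same_channel F (bloch_map a b c 0)"
      using F' trace_dist_bloch_map_le_imp_eq by metis
  next
    assume "same_channel F (bloch_map a b c 0)"
    then show "d E F \<le> ereal \<bar>t\<bar>"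
      using upper cong[OF E] by simp
  qed
  have "d E (bloch_map a b c 0) \<le> ereal \<bar>t\<bar>"
    using eq[OF P] by (simp add: same_channel_def)
  then show ?thesis
    unfolding closest_pauli_def is_arg_min_def
    using P ge eq pauli by (metis leD leI order_trans)
qed

theorem proposition19:
  fixes u :: nat and \<eta> q1 q2 q3 f11 f22 f33 :: real and E_sim E_cl :: qmap
  assumes u: "u \<in> {0, 1}"
    and eta: "\<eta> \<in> {0..1}"
    and q: "(q1, q2, q3) \<in> tetrahedron"
    and E_sim: "E_sim = (unitary_channel sigma_x ^^ u) \<circ> amplitude_damping \<eta> \<circ> pauli_map q1 q2 q3"
    and f: "(f11, f22, f33) =
      (if u = 0 then (sqrt (1 - \<eta>) * q1, - sqrt (1 - \<eta>) * q2, (1 - \<eta>) * q3)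
       else (sqrt (1 - \<eta>) * q1, sqrt (1 - \<eta>) * q2, - (1 - \<eta>) * q3))"
    and E_cl: "E_cl = bloch_map f11 f22 f33 0"
  shows "(\<forall>C. closest_pauli diamond_dist E_sim C \<longleftrightarrow> same_channel C E_cl) \<and>
    (\<forall>C. closest_pauli trace_dist E_sim C \<longleftrightarrow> same_channel C E_cl) \<and>
    diamond_dist E_sim E_cl = ereal \<eta>"
proof -
  \<comment> \<open>The final \<open>sigma_x\<close> flips the z coordinate, hence the sign of the
    shift.\<close>
  define t where "t = (if u = 0 then \<eta> else - \<eta>)"
  have sim: "same_channel E_sim (bloch_map f11 f22 f33 t)"
    using u f unfolding same_channel_def E_sim t_def
    by (auto simp: amplitude_damping_def pauli_map_def bloch_map_comp unitary_channel_sigma_x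
      minus_mult_left simp del: mult_minus_left)
  have "(sqrt (1 - \<eta>) * q1, sqrt (1 - \<eta>) * q2, (1 - \<eta>) * q3) \<in> tetrahedron"
    using tetrahedron_scale[OF q, of "sqrt (1 - \<eta>)"] eta by simp
  \<comment> \<open>The sign of f22 is reversed because \<open>pauli_map\<close> negates its second
    parameter. For u = 1 the second and third parameters both change sign, which merely exchanges
    the two facet inequalities.\<close>
  then have "(f11, - f22, f33) \<in> tetrahedron"
    using u f by (auto simp: tetrahedron_iff_ineqs algebra_simps)
  then have P: "E_cl \<in> pauli_channels"
    unfolding pauli_channels_iff E_cl
    by (intro exI[of _ f11] exI[of _ "- f22"] exI[of _ f33]) (simp add: pauli_map_def same_channel_def)
  have t: "\<bar>t\<bar> = \<eta>"
    using eta by (simp add: t_def)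
  have dd: "diamond_dist E_sim E_cl = ereal \<eta>"
    using same_channel_diamond_dist[OF sim, of E_cl E_cl] diamond_dist_bloch_map_shift[of f11 f22 f33 t]
    by (simp add: t E_cl same_channel_def)
  have le: "trace_dist (bloch_map a b c s) (bloch_map a' b' c' 0)
      \<le> diamond_dist (bloch_map a b c s) (bloch_map a' b' c' 0)" for a b c s a' b' c'
    by (rule trace_dist_le_diamond_dist[OF bloch_map_carrier bloch_map_carrier])
  have upper: "diamond_dist (bloch_map f11 f22 f33 t) (bloch_map f11 f22 f33 0) \<le> ereal \<bar>t\<bar>"
    by (simp only: diamond_dist_bloch_map_shift order_refl)
  have "closest_pauli diamond_dist E_sim C \<longleftrightarrow> same_channel C E_cl" for C
    unfolding E_cl
    by (rule closest_pauli_bloch_map[where d = diamond_dist, OF sim P[unfolded E_cl]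
      same_channel_diamond_dist le upper])
  moreover have "closest_pauli trace_dist E_sim C \<longleftrightarrow> same_channel C E_cl" for C
    unfolding E_cl
    by (rule closest_pauli_bloch_map[where d = trace_dist, OF sim P[unfolded E_cl]
      same_channel_trace_dist order_refl order_trans[OF le upper]])
  ultimately show ?thesis
    using dd by blast
qed

end
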